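(* Let $0\le p<n$ and let $\gamma=[1^p,n-p]\vdash n$ be the partition with $p$ parts equal to $1$ and one further part equal to $n-p$. Let $m>0$. If $n-p-m$ is even, then $$\mu_{n,m}(\gamma)=\frac{2{n+1-p\brack m}}{(n+1-p)!}\,|\mathcal{C}_\gamma|,$$ and if $n-p-m$ is odd, then $\mu_{n,m}(\gamma)=0$.
   Context: Fix $\omega=(1\,2\,\cdots\,n)$. For $\gamma\vdash n$ and $m\ge1$, $\mu_{n,m}(\gamma)$ is the number of pairs $(\sigma,\pi)$ of permutations of $[n]$ with $\sigma\pi=\omega$, $\sigma$ of cycle type $\gamma$, and $\pi$ having exactly $m$ cycles. $|\mathcal{C}_\gamma|$ is the number of permutations of $[n]$ of cycle type $\gamma$. ${n\brack k}$ is the unsigned Stirling number of the first kind (zero if $k>n$). *)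

theory Defs
  imports Complex_Main "HOL-Combinatorics.Combinatorics" "HOL-Library.Multiset"
begin

definition cyc_orbit :: "(nat \<Rightarrow> nat) \<Rightarrow> nat \<Rightarrow> nat set" where
  "cyc_orbit s x = {(s ^^ k) x | k. True}"

definition cycles_of :: "nat \<Rightarrow> (nat \<Rightarrow> nat) \<Rightarrow> nat set set" where
  "cycles_of n s = cyc_orbit s ` {1..n}"

definition num_cycles :: "nat \<Rightarrow> (nat \<Rightarrow> nat) \<Rightarrow> nat" where
  "num_cycles n s = card (cycles_of n s)"

definition cycle_type :: "nat \<Rightarrow> (nat \<Rightarrow> nat) \<Rightarrow> nat multiset" where
  "cycle_type n s = image_mset card (mset_set (cycles_of n s))"

definition omega :: "nat \<Rightarrow> nat \<Rightarrow> nat" where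
  "omega n i = (if i \<in> {1..n} then (if i = n then 1 else i + 1) else i)"

definition mu :: "nat \<Rightarrow> nat \<Rightarrow> nat multiset \<Rightarrow> nat" where
  "mu n m \<gamma> = card {(s, t). s permutes {1..n} \<and> t permutes {1..n} \<and> s \<circ> t = omega n
                      \<and> cycle_type n s = \<gamma> \<and> num_cycles n t = m}"

definition conj_class_size :: "nat \<Rightarrow> nat multiset \<Rightarrow> nat" where
  "conj_class_size n \<gamma> = card {s. s permutes {1..n} \<and> cycle_type n s = \<gamma>}"

definition hook_type :: "nat \<Rightarrow> nat \<Rightarrow> nat multiset" where
  "hook_type n p = replicate_mset p 1 + {#n - p#}"

end

theory Submission
  imports Defs
begin

text \<open>
  The heart of the matter is a result of Cori, Marcus and Schaeffer: every odd permutation of an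
  \<open>N\<close>-element set is a product of an \<open>N\<close>-cycle and an \<open>(N-1)\<close>-cycle (with a marked fixed point) in
  exactly \<open>2 (N-2)!\<close> ways, independently of the permutation. It follows by induction on \<open>N\<close>, cutting
  a point that the permutation moves out of all the permutations involved; the cutting is always a left
  multiplication by the transposition \<open>(y s(y))\<close>, which does not change the number of cycles.

  Summing over the odd permutations of \<open>k + 1\<close> points with \<open>m\<close> cycles, and cutting the fixed point of
  the \<open>k\<close>-cycle out of the \<open>(k+1)\<close>-cycle, gives the number of \<open>k\<close>-cycles whose product with a fixed
  \<open>k\<close>-cycle has \<open>m\<close> cycles. A permutation of hook type is a full cycle on a set \<open>S\<close> of
  \<open>n - p\<close> points, and all points outside \<open>S\<close> can be cut out of \<open>\<omega>\<close>.
\<close>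

section \<open>Counting cycles and cutting out points\<close>

text \<open>The carrier \<open>A\<close> is a parameter because points are cut out one at a time;
  fixed points in \<open>A\<close> count as cycles. On \<open>{1..n}\<close> this is
  \<open>num_cycles\<close>.\<close>

definition orbit_count :: "nat set \<Rightarrow> (nat \<Rightarrow> nat) \<Rightarrow> nat" where
  "orbit_count A s = card (cyc_orbit s ` A)"

text \<open>Degenerate carriers: the empty set has no full cycle, since it has no orbit, and a
  singleton has exactly one, the identity.\<close>

definition full_cycles :: "nat set \<Rightarrow> (nat \<Rightarrow> nat) set" where
  "full_cycles A = {s. s permutes A \<and> orbit_count A s = 1}"

section \<open>Orbits of permutations of a finite set\<close>

lemma cyc_orbit_eq_orbit:
  assumes "finite A" "s permutes A"
  shows "cyc_orbit s x = orbit s x"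
proof -
  have "permutation s" using assms unfolding permutation_permutes by auto
  then show ?thesis unfolding cyc_orbit_def by (rule orbit_altdef_permutation[symmetric])
qed

lemma self_in_cyc_orbit [simp]: "x \<in> cyc_orbit s x"
proof -
  have "x = (s ^^ 0) x" by simp
  then show ?thesis unfolding cyc_orbit_def by blast
qed

lemma cyc_orbit_subset:
  assumes "x \<in> X" "\<And>y. y \<in> X \<Longrightarrow> s y \<in> X"
  shows "cyc_orbit s x \<subseteq> X"
proof -
  have "(s ^^ k) x \<in> X" for k
    by (induction k) (use assms in auto)
  then show ?thesis unfolding cyc_orbit_def by auto
qed

lemma cyc_orbit_step: "y \<in> cyc_orbit s x \<Longrightarrow> s y \<in> cyc_orbit s x"
proof -
  assume "y \<in> cyc_orbit s x"
  then obtain k where "y = (s ^^ k) x" unfolding cyc_orbit_def by auto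
  then have "s y = (s ^^ Suc k) x" by simp
  then show "s y \<in> cyc_orbit s x" unfolding cyc_orbit_def by blast
qed

lemma cyc_orbit_eqI:
  assumes "finite A" "s permutes A" "y \<in> cyc_orbit s x"
  shows "cyc_orbit s y = cyc_orbit s x"
proof -
  have orb: "cyc_orbit s u = orbit s u" for u using cyc_orbit_eq_orbit[OF assms(1,2)] .
  have p: "permutation s" using assms unfolding permutation_permutes by auto
  have y: "y \<in> orbit s x" using assms(3) orb by simp
  have x: "x \<in> orbit s y" by (rule orbit_swap[OF permutation_self_in_orbit[OF p] y])
  show ?thesis unfolding orb using orbit_trans[OF _ x] orbit_trans[OF _ y] by blast
qed

lemma cyc_orbit_subset_carrier:
  assumes "s permutes A" "x \<in> A"
  shows "cyc_orbit s x \<subseteq> A"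
  using cyc_orbit_subset[OF assms(2)] permutes_in_image[OF assms(1)] by blast

lemma cyc_orbit_fixed: "s x = x \<Longrightarrow> cyc_orbit s x = {x}"
  using cyc_orbit_subset[of x "{x}" s] self_in_cyc_orbit[of x s] by blast

lemma orbit_count_pos:
  assumes "finite A" "A \<noteq> {}"
  shows "orbit_count A s > 0"
  using assms unfolding orbit_count_def by (simp add: card_gt_0_iff)

lemma orbit_count_insert_fixed:
  assumes "finite B" "s permutes B" "y \<notin> B"
  shows "orbit_count (insert y B) s = Suc (orbit_count B s)"
proof -
  have "s y = y" using assms permutes_not_in by metis
  then have y: "cyc_orbit s y = {y}" by (rule cyc_orbit_fixed)
  have "{y} \<notin> cyc_orbit s ` B"
    using assms cyc_orbit_subset_carrier by (metis imageE insert_subset)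
  then show ?thesis
    unfolding orbit_count_def using assms y by simp
qed

text \<open>Left multiplication by \<open>transpose y a\<close> inserts \<open>y\<close> just before
  \<open>a\<close> in the cycle of \<open>a\<close>: the preimage of \<open>a\<close> now goes to
  \<open>y\<close>, and \<open>y\<close> goes to \<open>a\<close>. All other arrows are kept, so no
  cycle is created or destroyed.\<close>

lemma orbit_count_insert_transpose:
  assumes fin: "finite B" and s: "s permutes B" and y: "y \<notin> B" and a: "a \<in> B"
  shows "orbit_count (insert y B) (transpose y a \<circ> s) = orbit_count B s"
proof -
  define t where "t = transpose y a \<circ> s"
  have sy: "s y = y" using s y permutes_not_in by metis
  have tper: "t permutes insert y B"
    unfolding t_def using s a permutes_subset[OF s, of "insert y B"]
    by (intro permutes_compose permutes_swap_id) auto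
  have finy: "finite (insert y B)" using fin by simp
  have sB: "s x \<in> B" if "x \<in> B" for x using s that permutes_in_image by metis
  have ty: "t y = a" unfolding t_def by (simp add: sy)
  have tx: "t x = (if s x = a then y else s x)" if "x \<in> B" for x
    unfolding t_def using sB[OF that] y by (auto simp: transpose_def)
  \<comment> \<open>Two steps of \<open>t\<close> through \<open>y\<close> replace the single step
    of \<open>s\<close> into \<open>a\<close>; hence the two orbits differ at most by
    \<open>y\<close>.\<close>
  have orb: "cyc_orbit t x - {y} = cyc_orbit s x" if x: "x \<in> B" for x
  proof
    have "s z \<in> cyc_orbit t x \<inter> B" if z: "z \<in> cyc_orbit t x \<inter> B" for z
    proof (cases "s z = a")
      case True
      then have "t (t z) = s z" using tx[of z] z ty by simp
      then show ?thesis using cyc_orbit_step[of _ t x] z sB by (metis Int_iff)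
    next
      case False
      then have "t z = s z" using tx[of z] z by simp
      then show ?thesis using cyc_orbit_step[of _ t x] z sB by (metis Int_iff)
    qed
    then have "cyc_orbit s x \<subseteq> cyc_orbit t x \<inter> B"
      using x by (intro cyc_orbit_subset) auto
    then show "cyc_orbit s x \<subseteq> cyc_orbit t x - {y}" using y by auto
    have sub: "cyc_orbit s x \<subseteq> B" using s x by (rule cyc_orbit_subset_carrier)
    show "cyc_orbit t x - {y} \<subseteq> cyc_orbit s x"
    proof (cases "a \<in> cyc_orbit s x")
      case True
      have "t z \<in> insert y (cyc_orbit s x)" if "z \<in> insert y (cyc_orbit s x)" for z
      proof (cases "z = y")
        case False
        then have z: "z \<in> cyc_orbit s x" "z \<in> B" using that sub by auto
        then show ?thesis using tx[of z] cyc_orbit_step[of z s x] by auto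
      qed (use True ty in simp)
      then have "cyc_orbit t x \<subseteq> insert y (cyc_orbit s x)"
        by (intro cyc_orbit_subset) auto
      then show ?thesis by auto
    next
      case False
      have "t z \<in> cyc_orbit s x" if "z \<in> cyc_orbit s x" for z
      proof -
        have "z \<in> B" "s z \<in> cyc_orbit s x" using that sub cyc_orbit_step by auto
        then show ?thesis using tx[of z] False by auto
      qed
      then have "cyc_orbit t x \<subseteq> cyc_orbit s x"
        by (intro cyc_orbit_subset) auto
      then show ?thesis by auto
    qed
  qed
  have "t y \<in> cyc_orbit t y" by (simp add: cyc_orbit_step)
  then have "cyc_orbit t y = cyc_orbit t a"
    using cyc_orbit_eqI[OF finy tper, of a y] ty by simp
  then have img: "cyc_orbit t ` insert y B = cyc_orbit t ` B" using a by auto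
  \<comment> \<open>An orbit is determined by any of its points, and each of these contains a point
    of \<open>B\<close>; so deleting \<open>y\<close> does not identify two orbits.\<close>
  have "inj_on (\<lambda>X. X - {y}) (cyc_orbit t ` B)"
  proof (rule inj_onI)
    fix X Y assume "X \<in> cyc_orbit t ` B" "Y \<in> cyc_orbit t ` B" and e: "X - {y} = Y - {y}"
    then obtain u v where u: "u \<in> B" "X = cyc_orbit t u" and v: "v \<in> B" "Y = cyc_orbit t v"
      by auto
    have "u \<in> X - {y}" using u y by auto
    then have "u \<in> cyc_orbit t v" using e v by auto
    then show "X = Y" using cyc_orbit_eqI[OF finy tper] u v by metis
  qed
  moreover have "(\<lambda>X. X - {y}) ` (cyc_orbit t ` B) = cyc_orbit s ` B"
    unfolding image_image using orb by simp
  ultimately have "card (cyc_orbit s ` B) = card (cyc_orbit t ` B)"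
    by (metis card_image)
  then show ?thesis unfolding orbit_count_def using img t_def by simp
qed

section \<open>Cutting points out of full cycles and inserting them\<close>

lemma permutes_cut:
  assumes "s permutes A" "y \<in> A"
  shows "transpose y (s y) \<circ> s permutes (A - {y})"
  using assms permutes_insert_lemma[of s y "A - {y}"] by (simp add: insert_absorb)

lemma permutes_insert_transpose:
  assumes "s permutes (A - {y})" "y \<in> A" "a \<in> A"
  shows "transpose y a \<circ> s permutes A"
  using assms by (intro permutes_compose permutes_swap_id permutes_subset[OF assms(1)]) auto

lemma transpose_cancel [simp]: "transpose a b \<circ> (transpose a b \<circ> f) = f"
  by (simp add: comp_assoc[symmetric])

text \<open>Inserting \<open>y\<close> before \<open>b\<close> and cutting it out again are the same
  left multiplication, since a transposition is an involution, and neither changes the number of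
  cycles.\<close>

lemma bij_betw_transpose_full_cycles:
  assumes fin: "finite A" and y: "y \<in> A" and b: "b \<in> A" "y \<noteq> b"
  shows "bij_betw (\<lambda>D. transpose y b \<circ> D) (full_cycles (A - {y})) {E \<in> full_cycles A. E y = b}"
proof (rule bij_betwI[where g = "\<lambda>D. transpose y b \<circ> D"])
  show "(\<lambda>D. transpose y b \<circ> D) \<in> full_cycles (A - {y}) \<rightarrow> {E \<in> full_cycles A. E y = b}"
  proof
    fix D assume D: "D \<in> full_cycles (A - {y})"
    then have p: "D permutes (A - {y})" and c: "orbit_count (A - {y}) D = 1"
      by (auto simp: full_cycles_def)
    have "D y = y" using p permutes_not_in by fastforce
    moreover have "orbit_count A (transpose y b \<circ> D) = 1"
      using orbit_count_insert_transpose[OF _ p, of y b] fin c b y by (simp add: insert_absorb)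
    moreover have "transpose y b \<circ> D permutes A"
      using permutes_insert_transpose[OF p] y b by blast
    ultimately show "transpose y b \<circ> D \<in> {E \<in> full_cycles A. E y = b}"
      by (simp add: full_cycles_def)
  qed
  show "(\<lambda>D. transpose y b \<circ> D) \<in> {E \<in> full_cycles A. E y = b} \<rightarrow> full_cycles (A - {y})"
  proof
    fix E assume "E \<in> {E \<in> full_cycles A. E y = b}"
    then have p: "E permutes A" and c: "orbit_count A E = 1" and e: "E y = b"
      by (auto simp: full_cycles_def)
    have q: "transpose y b \<circ> E permutes (A - {y})" using permutes_cut[OF p y] e by simp
    have "orbit_count A E = orbit_count (A - {y}) (transpose y b \<circ> E)"
      using orbit_count_insert_transpose[OF _ q, of y b] fin b y by (simp add: insert_absorb)
    then show "transpose y b \<circ> E \<in> full_cycles (A - {y})" using q c by (simp add: full_cycles_def)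
  qed
qed simp_all

lemma finite_full_cycles [simp]: "finite A \<Longrightarrow> finite (full_cycles A)"
  unfolding full_cycles_def by (rule finite_subset[OF _ finite_permutations[of A]]) auto

text \<open>A fixed point would be an orbit of its own next to at least one orbit on the remaining
  points.\<close>

lemma full_cycles_nofix:
  assumes "finite A" "E \<in> full_cycles A" "y \<in> A" "A - {y} \<noteq> {}"
  shows "E y \<noteq> y"
proof
  assume "E y = y"
  then have p: "E permutes (A - {y})" using permutes_cut[of E A y] assms by (simp add: full_cycles_def)
  have "orbit_count A E = Suc (orbit_count (A - {y}) E)"
    using orbit_count_insert_fixed[OF _ p, of y] assms by (simp add: insert_absorb)
  then show False
    using assms orbit_count_pos[of "A - {y}" E] by (simp add: full_cycles_def)
qed

lemma card_full_cycles_value: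
  assumes "finite A" "y \<in> A" "b \<in> A" "y \<noteq> b"
  shows "card {E \<in> full_cycles A. E y = b \<and> P E}
       = card {D \<in> full_cycles (A - {y}). P (transpose y b \<circ> D)}"
proof -
  let ?f = "\<lambda>D. transpose y b \<circ> D"
  have bij: "bij_betw ?f (full_cycles (A - {y})) {E \<in> full_cycles A. E y = b}"
    by (rule bij_betw_transpose_full_cycles[OF assms])
  have "{E \<in> full_cycles A. E y = b \<and> P E} = {E \<in> ?f ` full_cycles (A - {y}). P E}"
    using bij_betw_imp_surj_on[OF bij] by auto
  also have "\<dots> = ?f ` {D \<in> full_cycles (A - {y}). P (?f D)}" by blast
  finally show ?thesis
    using bij_betw_imp_inj_on[OF bij] by (simp add: card_image inj_on_subset)
qed

lemma card_full_cycles_by_image: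
  assumes fin: "finite A" and y: "y \<in> A" and ne: "A - {y} \<noteq> {}"
  shows "card {E \<in> full_cycles A. P E}
       = (\<Sum>b\<in>A - {y}. card {D \<in> full_cycles (A - {y}). P (transpose y b \<circ> D)})"
proof -
  have "{E \<in> full_cycles A. P E} = (\<Union>b\<in>A - {y}. {E \<in> full_cycles A. E y = b \<and> P E})"
    using full_cycles_nofix[OF fin _ y ne] y
    by (auto simp: full_cycles_def permutes_in_image)
  then have "card {E \<in> full_cycles A. P E} = (\<Sum>b\<in>A - {y}. card {E \<in> full_cycles A. E y = b \<and> P E})"
    using fin by (simp only:) (rule card_UN_disjoint, auto)
  also have "\<dots> = (\<Sum>b\<in>A - {y}. card {D \<in> full_cycles (A - {y}). P (transpose y b \<circ> D)})"
    using fin y by (intro sum.cong refl card_full_cycles_value) auto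
  finally show ?thesis .
qed

text \<open>The point cut out is the preimage \<open>b\<close> of \<open>z\<close>, so the smaller
  carrier \<open>A - {b}\<close> varies with the summand. The missing point \<open>b\<close> later
  becomes the marked point of \<open>near_cycle_pairs\<close>.\<close>

lemma card_full_cycles_by_preimage:
  assumes fin: "finite A" and z: "z \<in> A" and ne: "A - {z} \<noteq> {}"
  shows "card {E \<in> full_cycles A. P E}
       = (\<Sum>b\<in>A - {z}. card {D \<in> full_cycles (A - {b}). P (transpose z b \<circ> D)})"
proof -
  have "{E \<in> full_cycles A. P E} = (\<Union>b\<in>A - {z}. {E \<in> full_cycles A. E b = z \<and> P E})"
  proof -
    have "\<exists>b\<in>A - {z}. E b = z" if E: "E \<in> full_cycles A" for E
    proof -
      have p: "E permutes A" using E by (simp add: full_cycles_def)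
      then obtain b where "b \<in> A" "E b = z" using z permutes_image by (metis imageE)
      moreover have "E z \<noteq> z" using full_cycles_nofix[OF fin E z ne] .
      ultimately show ?thesis by auto
    qed
    then show ?thesis by blast
  qed
  moreover have "{E \<in> full_cycles A. E b = z \<and> P E} \<inter> {E \<in> full_cycles A. E c = z \<and> P E} = {}"
    if "b \<noteq> c" for b c
  proof -
    have "\<forall>E\<in>full_cycles A. E b \<noteq> E c"
      using that permutes_inj[of _ A] by (auto simp: full_cycles_def inj_eq)
    then show ?thesis by auto
  qed
  ultimately have "card {E \<in> full_cycles A. P E}
      = (\<Sum>b\<in>A - {z}. card {E \<in> full_cycles A. E b = z \<and> P E})"
    using fin by (simp only:) (rule card_UN_disjoint, simp_all)
  also have "\<dots> = (\<Sum>b\<in>A - {z}. card {D \<in> full_cycles (A - {b}). P (transpose z b \<circ> D)})"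
  proof (rule sum.cong[OF refl])
    fix b assume "b \<in> A - {z}"
    then show "card {E \<in> full_cycles A. E b = z \<and> P E}
        = card {D \<in> full_cycles (A - {b}). P (transpose z b \<circ> D)}"
      using card_full_cycles_value[OF fin, of b z P] z by (simp add: transpose_commute[of b z])
  qed
  finally show ?thesis .
qed

section \<open>Sign and Stirling numbers\<close>

text \<open>Removing a fixed point lowers both the number of points and the number of cycles;
  cutting out a moved point lowers only the former and costs one transposition.\<close>

lemma sign_orbit_count:
  assumes "finite A" "s permutes A"
  shows "sign s = (- 1) ^ (card A + orbit_count A s)"
  using assms
proof (induction A arbitrary: s rule: finite_induct)
  case empty
  then show ?case by (simp add: orbit_count_def)
next
  case (insert y B)
  define r where "r = transpose y (s y) \<circ> s"
  have r: "r permutes B" using permutes_insert_lemma[OF insert.prems] r_def by simp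
  have s: "s = transpose y (s y) \<circ> r" by (simp add: r_def)
  have pr: "permutation r" using r insert.hyps unfolding permutation_permutes by auto
  have sgn: "sign s = sign (transpose y (s y)) * sign r"
    using sign_compose[OF permutation_swap_id[of y "s y"] pr] s by simp
  show ?case
  proof (cases "s y = y")
    case True
    then have "s = r" using s by simp
    then show ?thesis
      using insert.IH[OF r] insert.hyps orbit_count_insert_fixed[OF _ r] by simp
  next
    case False
    have "s y \<in> B" using False insert.prems permutes_in_image[of s "insert y B" y] by simp
    then have "orbit_count (insert y B) s = orbit_count B r"
      using orbit_count_insert_transpose[OF _ r] insert.hyps s by metis
    then show ?thesis
      using insert.IH[OF r] insert.hyps sgn False by (simp add: sign_swap_id)
  qed
qed

text \<open>The image of the new point \<open>y\<close> yields the Stirling recurrence: each image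
  \<open>b\<close> in \<open>B\<close> contributes the permutations of \<open>B\<close> with
  \<open>m\<close> cycles, and a fixed \<open>y\<close> contributes those with one cycle
  less.\<close>

lemma card_permutes_orbit_count:
  assumes "finite A"
  shows "card {s. s permutes A \<and> orbit_count A s = m} = stirling (card A) m"
  using assms
proof (induction A arbitrary: m rule: finite_induct)
  case empty
  have "{s. s permutes {} \<and> orbit_count {} s = m} = (if m = 0 then {id} else {})"
    by (auto simp: orbit_count_def)
  then show ?case by (cases m) auto
next
  case (insert y B)
  let ?S = "\<lambda>b. {s. s permutes insert y B \<and> s y = b \<and> orbit_count (insert y B) s = m}"
  have fin: "finite (?S b)" for b
    using insert.hyps by (intro finite_subset[OF _ finite_permutations[of "insert y B"]]) auto
  have "{s. s permutes insert y B \<and> orbit_count (insert y B) s = m} = (\<Union>b\<in>insert y B. ?S b)"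
    using permutes_in_image[of _ "insert y B" y] by blast
  then have "card {s. s permutes insert y B \<and> orbit_count (insert y B) s = m}
      = (\<Sum>b\<in>insert y B. card (?S b))"
    using insert.hyps fin by (simp only:) (rule card_UN_disjoint, auto)
  also have "\<dots> = card (?S y) + (\<Sum>b\<in>B. card (?S b))" using insert.hyps by simp
  also have "(\<Sum>b\<in>B. card (?S b)) = (\<Sum>b\<in>B. stirling (card B) m)"
  proof (rule sum.cong[OF refl])
    fix b assume b: "b \<in> B"
    have "bij_betw (\<lambda>s. transpose y b \<circ> s) {s. s permutes B \<and> orbit_count B s = m} (?S b)"
    proof (rule bij_betwI[where g = "\<lambda>s. transpose y b \<circ> s"])
      show "(\<lambda>s. transpose y b \<circ> s) \<in> {s. s permutes B \<and> orbit_count B s = m} \<rightarrow> ?S b"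
      proof
        fix s assume "s \<in> {s. s permutes B \<and> orbit_count B s = m}"
        then have s: "s permutes B" "orbit_count B s = m" by auto
        have "s y = y" using s insert.hyps permutes_not_in by metis
        moreover have "transpose y b \<circ> s permutes insert y B"
          using permutes_insert_transpose[of s "insert y B" y b] s b insert.hyps by simp
        ultimately show "transpose y b \<circ> s \<in> ?S b"
          using orbit_count_insert_transpose[OF _ s(1)] s b insert.hyps by simp
      qed
      show "(\<lambda>s. transpose y b \<circ> s) \<in> ?S b \<rightarrow> {s. s permutes B \<and> orbit_count B s = m}"
      proof
        fix s assume "s \<in> ?S b"
        then have s: "s permutes insert y B" "s y = b" "orbit_count (insert y B) s = m" by auto
        have r: "transpose y b \<circ> s permutes B" using permutes_insert_lemma[OF s(1)] s by simp
        have "orbit_count (insert y B) s = orbit_count B (transpose y b \<circ> s)"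
          using orbit_count_insert_transpose[OF _ r, of y b] insert.hyps b by simp
        then show "transpose y b \<circ> s \<in> {s. s permutes B \<and> orbit_count B s = m}"
          using r s by simp
      qed
    qed simp_all
    then have "card {s. s permutes B \<and> orbit_count B s = m} = card (?S b)" by (rule bij_betw_same_card)
    then show "card (?S b) = stirling (card B) m" using insert.IH[of m] by simp
  qed
  also have "\<dots> = card B * stirling (card B) m" by simp
  \<comment> \<open>Writing \<open>Suc (orbit_count B s) = m\<close> instead of subtracting keeps
    the case \<open>m = 0\<close> correct: the set is then empty.\<close>
  also have "?S y = {s. s permutes B \<and> Suc (orbit_count B s) = m}"
  proof -
    have "s permutes insert y B \<and> s y = y \<longleftrightarrow> s permutes B" for s
      using permutes_insert_lemma[of s y B] permutes_subset[of s B "insert y B"]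
        permutes_not_in[of s B y] insert.hyps by auto
    then have "?S y = {s. s permutes B \<and> orbit_count (insert y B) s = m}" by blast
    then show ?thesis using orbit_count_insert_fixed insert.hyps by auto
  qed
  also have "card \<dots> + card B * stirling (card B) m = stirling (card (insert y B)) m"
    using insert.IH insert.hyps by (cases m; cases "card B") auto
  finally show ?case .
qed

lemma card_full_cycles:
  assumes "finite A" "A \<noteq> {}"
  shows "card (full_cycles A) = fact (card A - 1)"
  using card_permutes_orbit_count[OF assms(1), of 1] assms stirling_Suc_n_1[of "card A - 1"]
  by (simp add: full_cycles_def card_gt_0_iff)

section \<open>Products of an N-cycle and an (N-1)-cycle\<close>

lemma full_cycles_cut_iff:
  assumes "finite A" "s permutes A" "y \<in> A" "s y \<noteq> y"
  shows "s \<in> full_cycles A \<longleftrightarrow> transpose y (s y) \<circ> s \<in> full_cycles (A - {y})"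
proof -
  have p: "transpose y (s y) \<circ> s permutes (A - {y})" by (rule permutes_cut[OF assms(2,3)])
  have "s y \<in> A - {y}" using assms permutes_in_image[OF assms(2), of y] by simp
  then have "orbit_count A s = orbit_count (A - {y}) (transpose y (s y) \<circ> s)"
    using orbit_count_insert_transpose[OF _ p, of y "s y"] assms by (simp add: insert_absorb)
  then show ?thesis using p assms by (simp add: full_cycles_def)
qed

text \<open>
  Full cycles are closed under inversion, so the solutions \<open>D\<close> below correspond to the factorizations
  of \<open>s\<close> as \<open>(s \<circ> D) \<circ> D\<^sup>-\<^sup>1\<close>.
\<close>

definition cycle_pairs :: "nat set \<Rightarrow> (nat \<Rightarrow> nat) \<Rightarrow> nat" where
  "cycle_pairs A s = card {D \<in> full_cycles A. s \<circ> D \<in> full_cycles A}"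

text \<open>\<open>D\<close> is an (N-1)-cycle whose fixed point \<open>j\<close> is marked. The
  mark matters when \<open>A\<close> has two points, where both choices of \<open>j\<close> leave
  only \<open>D = id\<close>.\<close>

definition near_cycle_pairs :: "nat set \<Rightarrow> (nat \<Rightarrow> nat) \<Rightarrow> nat \<Rightarrow> nat" where
  "near_cycle_pairs A s j = card {D \<in> full_cycles (A - {j}). s \<circ> D \<in> full_cycles A}"

lemma full_cycles_permutes: "D \<in> full_cycles A \<Longrightarrow> D permutes A"
  by (simp add: full_cycles_def)

text \<open>\<open>D\<close> fixes \<open>j\<close>, so \<open>s \<circ> D\<close> sends
  \<open>j\<close> to \<open>s j\<close>. Cutting \<open>j\<close> out of the product multiplies on
  the left by \<open>transpose j (s j)\<close>, which is absorbed by \<open>s\<close> and leaves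
  \<open>D\<close> alone.\<close>

lemma near_cycle_pairs_cut:
  assumes fin: "finite A" and s: "s permutes A" and j: "j \<in> A" "s j \<noteq> j"
  shows "near_cycle_pairs A s j = cycle_pairs (A - {j}) (transpose j (s j) \<circ> s)"
proof -
  have "s \<circ> D \<in> full_cycles A \<longleftrightarrow> (transpose j (s j) \<circ> s) \<circ> D \<in> full_cycles (A - {j})"
    if D: "D \<in> full_cycles (A - {j})" for D
  proof -
    have p: "D permutes (A - {j})" using D by (rule full_cycles_permutes)
    have "D j = j" using permutes_not_in[OF p] by simp
    moreover have "s \<circ> D permutes A" by (rule permutes_compose[OF permutes_subset[OF p] s]) auto
    ultimately show ?thesis using full_cycles_cut_iff[OF fin, of "s \<circ> D" j] j by (simp add: comp_assoc)
  qed
  then have "{D \<in> full_cycles (A - {j}). s \<circ> D \<in> full_cycles A}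
      = {D \<in> full_cycles (A - {j}). (transpose j (s j) \<circ> s) \<circ> D \<in> full_cycles (A - {j})}"
    by blast
  then show ?thesis unfolding near_cycle_pairs_def cycle_pairs_def by (rule arg_cong)
qed

text \<open>With \<open>b\<close> the preimage of \<open>z\<close>, a full cycle is
  \<open>transpose z b\<close> composed with a full cycle on \<open>A - {b}\<close>; the
  transposition is absorbed by \<open>s\<close>.\<close>

lemma cycle_pairs_expand:
  assumes "finite A" "z \<in> A" "A - {z} \<noteq> {}"
  shows "cycle_pairs A s = (\<Sum>b\<in>A - {z}. near_cycle_pairs A (s \<circ> transpose z b) b)"
  unfolding cycle_pairs_def near_cycle_pairs_def
  by (subst card_full_cycles_by_preimage[OF assms]) (simp add: comp_assoc)

text \<open>The point \<open>y\<close> is cut out of both \<open>D\<close> and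
  \<open>s \<circ> D\<close>. With \<open>b\<close> the image of \<open>y\<close> under
  \<open>D\<close>, the product sends \<open>y\<close> to \<open>s b\<close>; the value
  \<open>b = z\<close> would make \<open>y\<close> a fixed point of a full cycle and is
  excluded.\<close>

lemma near_cycle_pairs_expand:
  assumes fin: "finite A" and s: "s permutes A"
    and y: "y \<in> A" "s y \<noteq> y" and z: "s z = y" and j: "j \<in> A - {y}" and ne: "A - {j} - {y} \<noteq> {}"
  shows "near_cycle_pairs A s j
       = (\<Sum>b\<in>A - {y} - {j} - {z}. near_cycle_pairs (A - {y}) (transpose y (s y) \<circ> s \<circ> transpose z b) j)"
proof -
  have zy: "z \<noteq> y" using y z by auto
  let ?g = "transpose y (s y) \<circ> s"
  let ?t = "\<lambda>b. card {D \<in> full_cycles (A - {j} - {y}). s \<circ> (transpose y b \<circ> D) \<in> full_cycles A}"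
  have t: "?t b = (if b = z then 0 else near_cycle_pairs (A - {y}) (?g \<circ> transpose z b) j)"
    if b: "b \<in> A - {j} - {y}" for b
  proof -
    have iff: "s \<circ> (transpose y b \<circ> D) \<in> full_cycles A \<longleftrightarrow>
        b \<noteq> z \<and> (?g \<circ> transpose z b) \<circ> D \<in> full_cycles (A - {y})"
      if D: "D \<in> full_cycles (A - {j} - {y})" for D
    proof -
      let ?E = "s \<circ> (transpose y b \<circ> D)"
      have p: "D permutes (A - {j} - {y})" using D by (rule full_cycles_permutes)
      have Dy: "D y = y" using permutes_not_in[OF p] by simp
      have Ey: "?E y = s b" by (simp add: Dy)
      have E: "?E permutes A"
        using b y by (intro permutes_compose[OF permutes_compose[OF permutes_subset[OF p]] s]
            permutes_swap_id) auto
      show ?thesis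
      proof (cases "b = z")
        case True
        then have "?E y = y" using Ey z by simp
        then have "?E \<notin> full_cycles A" using full_cycles_nofix[OF fin _ y(1), of ?E] b by auto
        then show ?thesis using True by simp
      next
        case False
        have inj: "s u = s v \<longleftrightarrow> u = v" for u v using permutes_inj[OF s] by (auto dest: injD)
        have "?E y \<noteq> y" using Ey z inj False by metis
        then have "?E \<in> full_cycles A \<longleftrightarrow> transpose y (s b) \<circ> ?E \<in> full_cycles (A - {y})"
          using full_cycles_cut_iff[OF fin E y(1)] Ey by simp
        \<comment> \<open>Both sides fix \<open>y\<close>, send \<open>b\<close> to
          \<open>s y\<close> and \<open>z\<close> to \<open>s b\<close>, and agree with
          \<open>s\<close> elsewhere.\<close>
        moreover have "transpose y (s b) \<circ> (s \<circ> transpose y b) = ?g \<circ> transpose z b"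
        proof
          fix x
          have sz: "s x = y \<longleftrightarrow> x = z" for x using z inj by metis
          show "(transpose y (s b) \<circ> (s \<circ> transpose y b)) x = (?g \<circ> transpose z b) x"
            using zy False b y z inj by (auto simp: transpose_def sz)
        qed
        ultimately show ?thesis using False by (simp add: comp_assoc[symmetric])
      qed
    qed
    have comm: "A - {j} - {y} = A - {y} - {j}" by auto
    show ?thesis
    proof (cases "b = z")
      case True
      then have "{D \<in> full_cycles (A - {j} - {y}). s \<circ> (transpose y b \<circ> D) \<in> full_cycles A} = {}"
        using iff by blast
      then have "?t b = 0" by (simp only: card.empty)
      then show ?thesis using True by simp
    next
      case False
      then have "{D \<in> full_cycles (A - {j} - {y}). s \<circ> (transpose y b \<circ> D) \<in> full_cycles A}
          = {D \<in> full_cycles (A - {y} - {j}). (?g \<circ> transpose z b) \<circ> D \<in> full_cycles (A - {y})}"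
        using iff unfolding comm by blast
      then have "?t b = near_cycle_pairs (A - {y}) (?g \<circ> transpose z b) j"
        unfolding near_cycle_pairs_def by (rule arg_cong)
      then show ?thesis using False by simp
    qed
  qed
  have "near_cycle_pairs A s j = (\<Sum>b\<in>A - {j} - {y}. ?t b)"
    unfolding near_cycle_pairs_def
    using card_full_cycles_by_image[of "A - {j}" y "\<lambda>E. s \<circ> E \<in> full_cycles A"] fin y j ne by auto
  also have "\<dots> = (\<Sum>b\<in>A - {j} - {y}. if b = z then 0 else near_cycle_pairs (A - {y}) (?g \<circ> transpose z b) j)"
    using t by (rule sum.cong[OF refl])
  also have "\<dots> = (\<Sum>b\<in>A - {y} - {j} - {z}. near_cycle_pairs (A - {y}) (?g \<circ> transpose z b) j)"
    using fin by (intro sum.mono_neutral_cong_right) auto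
  finally show ?thesis .
qed

lemma full_cycles_singleton [simp]: "full_cycles {x} = {id}"
  by (auto simp: full_cycles_def orbit_count_def)

text \<open>
  The terms with \<open>j \<noteq> y\<close> reduce to the induction hypothesis except for the missing diagonal ones; these
  add up to \<open>cycle_pairs\<close> of the cut permutation (decompose a full cycle by the preimage of \<open>z\<close>),
  which is exactly what the term \<open>j = y\<close> contributes.
\<close>

lemma sum_near_cycle_pairs_odd:
  assumes "finite A" "s permutes A" "sign s = - 1"
  shows "(\<Sum>j\<in>A. near_cycle_pairs A s j) = 2 * fact (card A - 2)"
  using assms
proof (induction "card A" arbitrary: A s rule: less_induct)
  case less
  note fin = less.prems(1) and s = less.prems(2)
  have "s \<noteq> id"
  proof
    assume "s = id"
    then show False using less.prems(3) by (simp add: sign_id)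
  qed
  then obtain y where y: "s y \<noteq> y" by (auto simp: fun_eq_iff)
  have yA: "y \<in> A" using y permutes_not_in[OF s] by blast
  have syA: "s y \<in> A - {y}" using y yA permutes_in_image[OF s, of y] by simp
  have z: "s (inv s y) = y" by (rule permutes_inverses(1)[OF s])
  define z where "z = inv s y"
  note z = z[folded z_def]
  have zy: "z \<noteq> y" using z y by auto
  have zA: "z \<in> A - {y}" using z yA zy permutes_in_image[OF s, of z] by simp
  let ?B = "A - {y}"
  let ?g = "transpose y (s y) \<circ> s"
  have g: "?g permutes ?B" using permutes_cut[OF s yA] .
  have finB: "finite ?B" using fin by simp
  have cardA: "card A = Suc (card ?B)" by (rule card.remove[OF fin yA])
  have perm: "permutation s" using s fin unfolding permutation_permutes by auto
  have ny: "near_cycle_pairs A s y = cycle_pairs ?B ?g"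
    using near_cycle_pairs_cut[OF fin s yA y] .
  have split: "(\<Sum>j\<in>A. near_cycle_pairs A s j) = near_cycle_pairs A s y + (\<Sum>j\<in>?B. near_cycle_pairs A s j)"
    using sum.remove[OF fin yA] by metis
  show ?case
  proof (cases "?B - {z} = {}")
    case True
    \<comment> \<open>Two points: \<open>s\<close> exchanges them, \<open>D = id\<close> works for
      either marked point, and the right-hand side is \<open>2 * fact 0\<close>.\<close>
    then have B: "?B = {z}" using zA by auto
    then have A: "A = {y, z}" using yA by auto
    have sy: "s y = z" using syA B by auto
    have id: "?g = id" using g B by auto
    have "cycle_pairs ?B ?g = 1"
      unfolding id B cycle_pairs_def by (simp add: Collect_conv_if)
    moreover have "near_cycle_pairs A s z = 1"
    proof -
      have "A - {z} = {y}" using A zy by auto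
      moreover have "s \<in> full_cycles A"
        using full_cycles_cut_iff[OF fin s yA y] id B by simp
      ultimately show ?thesis unfolding near_cycle_pairs_def by (simp add: Collect_conv_if)
    qed
    ultimately have "(\<Sum>j\<in>A. near_cycle_pairs A s j) = 2" using split ny B by simp
    moreover have "card A = 2" using A zy by simp
    ultimately show ?thesis by simp
  next
    case False
    then obtain w where w: "w \<in> ?B - {z}" by auto
    let ?h = "\<lambda>b. ?g \<circ> transpose z b"
    have IH: "(\<Sum>j\<in>?B. near_cycle_pairs ?B (?h b) j) = 2 * fact (card ?B - 2)"
      if b: "b \<in> ?B - {z}" for b
    proof (rule less.hyps)
      show "card ?B < card A" using cardA by simp
      show "finite ?B" by (rule finB)
      show "?h b permutes ?B" using b zA by (intro permutes_compose[OF _ g] permutes_swap_id) auto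
      \<comment> \<open>Since \<open>s y \<noteq> y\<close> and \<open>b \<noteq> z\<close>, two
        genuine transpositions are multiplied to \<open>s\<close>, so the permutation on the smaller
        set is odd again.\<close>
      have "sign (?h b) = (sign (transpose y (s y)) * sign s) * sign (transpose z b)"
        using perm by (simp only: sign_compose permutation_swap_id permutation_compose)
      then show "sign (?h b) = - 1" using less.prems(3) y b by (auto simp: sign_swap_id)
    qed
    have Bj: "A - {j} - {y} \<noteq> {}" for j using w zA by auto
    have "(\<Sum>j\<in>?B. near_cycle_pairs A s j)
        = (\<Sum>j\<in>?B. \<Sum>b\<in>?B - {j} - {z}. near_cycle_pairs ?B (?h b) j)"
      using near_cycle_pairs_expand[OF fin s yA y z _ Bj] by (intro sum.cong refl) auto
    also have "\<dots> = (\<Sum>j\<in>?B. \<Sum>b\<in>?B - {z}. if b = j then 0 else near_cycle_pairs ?B (?h b) j)"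
      using finB by (intro sum.cong refl sum.mono_neutral_cong_left) auto
    also have "\<dots> = (\<Sum>b\<in>?B - {z}. \<Sum>j\<in>?B. if b = j then 0 else near_cycle_pairs ?B (?h b) j)"
      by (rule sum.swap)
    also have "\<dots> = (\<Sum>b\<in>?B - {z}. \<Sum>j\<in>?B - {b}. near_cycle_pairs ?B (?h b) j)"
      using finB by (intro sum.cong refl sum.mono_neutral_cong_right) auto
    finally have S: "(\<Sum>j\<in>?B. near_cycle_pairs A s j)
        = (\<Sum>b\<in>?B - {z}. \<Sum>j\<in>?B - {b}. near_cycle_pairs ?B (?h b) j)" .
    have "near_cycle_pairs A s y = (\<Sum>b\<in>?B - {z}. near_cycle_pairs ?B (?h b) b)"
      using ny cycle_pairs_expand[OF finB zA False] by simp
    then have "(\<Sum>j\<in>A. near_cycle_pairs A s j)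
        = (\<Sum>b\<in>?B - {z}. near_cycle_pairs ?B (?h b) b + (\<Sum>j\<in>?B - {b}. near_cycle_pairs ?B (?h b) j))"
      using split S by (simp add: sum.distrib)
    also have "\<dots> = (\<Sum>b\<in>?B - {z}. \<Sum>j\<in>?B. near_cycle_pairs ?B (?h b) j)"
      using finB by (intro sum.cong refl) (subst (2) sum.remove, auto)
    also have "\<dots> = (\<Sum>b\<in>?B - {z}. 2 * fact (card ?B - 2))"
      by (rule sum.cong[OF refl IH])
    also have "\<dots> = card (?B - {z}) * (2 * fact (card ?B - 2))" by simp
    also have "card (?B - {z}) = card ?B - 1" using finB zA by simp
    also have "(card ?B - 1) * (2 * fact (card ?B - 2)) = (2 * fact (card ?B - 1) :: nat)"
    proof -
      \<comment> \<open>Positivity of \<open>card ?B - 1\<close> makes the truncated subtractions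
        exact, so that the number of terms is the missing factor of the factorial.\<close>
      have "card (?B - {z}) > 0" using w finB by (metis card_gt_0_iff empty_iff finite_Diff)
      then have "card ?B - 1 > 0" using finB zA by simp
      then have "card ?B - 1 = Suc (card ?B - 2)" by simp
      then show ?thesis by (metis fact_Suc mult.left_commute of_nat_id)
    qed
    finally show ?thesis using cardA by simp
  qed
qed

text \<open>A full cycle on \<open>A\<close> and one on \<open>A - {j}\<close> have opposite signs,
  so the quotient of the two is never even.\<close>

lemma near_cycle_pairs_even:
  assumes fin: "finite A" "card A \<ge> 2" and s: "s permutes A" "sign s = 1" and j: "j \<in> A"
  shows "near_cycle_pairs A s j = 0"
proof -
  have "s \<circ> D \<notin> full_cycles A" if D: "D \<in> full_cycles (A - {j})" for D
  proof
    assume E: "s \<circ> D \<in> full_cycles A"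
    have "sign (s \<circ> D) = (- 1) ^ (card A + 1)"
      using sign_orbit_count[OF fin(1), of "s \<circ> D"] E by (simp add: full_cycles_def)
    moreover have "sign D = (- 1) ^ (card A - 1 + 1)"
      using sign_orbit_count[of "A - {j}" D] D fin j by (simp add: full_cycles_def)
    moreover have "sign (s \<circ> D) = sign s * sign D"
    proof (rule sign_compose)
      show "permutation s" using s fin unfolding permutation_permutes by auto
      show "permutation D"
        using full_cycles_permutes[OF D] fin unfolding permutation_permutes by (auto intro!: exI[of _ "A - {j}"])
    qed
    ultimately show False using s fin by simp
  qed
  then have "{D \<in> full_cycles (A - {j}). s \<circ> D \<in> full_cycles A} = {}" by blast
  then show ?thesis unfolding near_cycle_pairs_def by (simp only: card.empty)
qed

section \<open>Products of two k-cycles\<close>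

lemma full_cycles_orbit:
  assumes fin: "finite B" and w: "w \<in> full_cycles B" and b: "b \<in> B"
  shows "cyc_orbit w b = B"
proof -
  have p: "w permutes B" using w by (rule full_cycles_permutes)
  have "card (cyc_orbit w ` B) = 1" using w by (simp add: full_cycles_def orbit_count_def)
  then obtain X where X: "cyc_orbit w ` B = {X}" by (rule card_1_singletonE)
  have "x \<in> cyc_orbit w b" if x: "x \<in> B" for x
  proof -
    have "cyc_orbit w x = X" "cyc_orbit w b = X" using imageI[OF x, of "cyc_orbit w"] imageI[OF b, of "cyc_orbit w"] X by simp_all
    then have "cyc_orbit w x = cyc_orbit w b" by simp
    then show ?thesis using self_in_cyc_orbit[of x w] by simp
  qed
  moreover have "cyc_orbit w b \<subseteq> B" by (rule cyc_orbit_subset_carrier[OF p b])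
  ultimately show ?thesis by blast
qed

lemma full_cyclesI:
  assumes fin: "finite B" and p: "w permutes B" and b: "b \<in> B" and sub: "B \<subseteq> cyc_orbit w b"
  shows "w \<in> full_cycles B"
proof -
  have "cyc_orbit w x = cyc_orbit w b" if "x \<in> B" for x
    by (rule cyc_orbit_eqI[OF fin p subsetD[OF sub that]])
  then have "cyc_orbit w ` B = (\<lambda>_. cyc_orbit w b) ` B" by (rule image_cong[OF refl])
  also have "\<dots> = {cyc_orbit w b}" using b by (rule image_constant)
  finally show ?thesis using p by (simp add: full_cycles_def orbit_count_def)
qed

lemma orbit_count_inv:
  assumes "finite B" "s permutes B"
  shows "orbit_count B (inv s) = orbit_count B s"
proof -
  have "permutation s" using assms unfolding permutation_permutes by auto
  then have "cyc_orbit (inv s) = cyc_orbit s"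
    using cyc_orbit_eq_orbit[OF assms] cyc_orbit_eq_orbit[OF assms(1) permutes_inv[OF assms(2)]]
    by (simp add: fun_eq_iff orbit_inv_eq)
  then show ?thesis by (simp add: orbit_count_def)
qed

lemma inv_full_cycles:
  assumes "finite B" "s \<in> full_cycles B"
  shows "inv s \<in> full_cycles B"
  using assms permutes_inv[of s B] orbit_count_inv[of B s] by (simp add: full_cycles_def)

lemma card_full_cycles_inv:
  assumes fin: "finite B"
  shows "card {s \<in> full_cycles B. P (inv s)} = card {s \<in> full_cycles B. P s}"
proof -
  have ii: "inv (inv s) = s" if "s \<in> full_cycles B" for s
    using permutes_inv_inv[OF full_cycles_permutes[OF that]] .
  have "bij_betw inv {s \<in> full_cycles B. P (inv s)} {s \<in> full_cycles B. P s}"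
    by (rule bij_betwI[where g = inv]) (auto simp: ii inv_full_cycles[OF fin])
  then show ?thesis by (rule bij_betw_same_card)
qed

text \<open>Relabelling along \<open>h\<close> commutes with iteration, so \<open>h\<close> carries
  the orbits of \<open>s\<close> bijectively to those of the conjugate.\<close>

lemma orbit_count_map_permutation:
  assumes h: "bij_betw h B B'" and s: "s permutes B"
  shows "orbit_count B' (map_permutation B h s) = orbit_count B s"
proof -
  define s' where "s' = map_permutation B h s"
  have inj: "inj_on h B" using h by (rule bij_betw_imp_inj_on)
  have sk: "(s ^^ k) x \<in> B" if "x \<in> B" for k x
    using that permutes_in_image[OF s] by (induction k) auto
  have pow: "(s' ^^ k) (h x) = h ((s ^^ k) x)" if "x \<in> B" for k x
    by (induction k) (use map_permutation_apply[OF inj sk[OF that]] s'_def in auto)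
  have orb: "cyc_orbit s' (h x) = h ` cyc_orbit s x" if "x \<in> B" for x
    unfolding cyc_orbit_def using pow[OF that] by auto
  have "B' = h ` B" using bij_betw_imp_surj_on[OF h] by simp
  then have "cyc_orbit s' ` B' = (`) h ` (cyc_orbit s ` B)"
    using orb by (simp add: image_image)
  moreover have "inj_on ((`) h) (cyc_orbit s ` B)"
    by (rule inj_on_subset[OF inj_on_image_Pow[OF inj]]) (use cyc_orbit_subset_carrier[OF s] in auto)
  ultimately show ?thesis unfolding orbit_count_def s'_def[symmetric] by (simp add: card_image)
qed

text \<open>Each cycle lists its carrier by the iterates of a base point; matching equal positions
  of the two lists is the required \<open>h\<close>.\<close>

lemma full_cycles_conjugate:
  assumes fin: "finite B" "finite B'" and ne: "B \<noteq> {}" and card: "card B = card B'"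
    and w: "w \<in> full_cycles B" and w': "w' \<in> full_cycles B'"
  obtains h where "bij_betw h B B'" "map_permutation B h w = w'"
proof -
  obtain b where b: "b \<in> B" using ne by auto
  have "B' \<noteq> {}" using ne card fin by auto
  then obtain b' where b': "b' \<in> B'" by auto
  define e where "e = (\<lambda>(v :: nat \<Rightarrow> nat) c (i::nat). (v ^^ i) c)"
  \<comment> \<open>\<open>funpow_dist1\<close> is the first return time to \<open>c\<close>; the
    iterates before it list the orbit without repetition, so it equals
    \<open>card C\<close>.\<close>
  have enum: "bij_betw (e v c) {0..<card C} C \<and> e v c (card C) = c"
    if C: "finite C" "v \<in> full_cycles C" "c \<in> C" for v c C
  proof -
    have p: "v permutes C" using C(2) by (rule full_cycles_permutes)
    have perm: "permutation v" using p C(1) unfolding permutation_permutes by auto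
    have orb: "orbit v c = C"
      using full_cycles_orbit[OF C] cyc_orbit_eq_orbit[OF C(1) p] by simp
    have self: "c \<in> orbit v c" by (rule permutation_self_in_orbit[OF perm])
    let ?k = "funpow_dist1 v c c"
    have "C = e v c ` {0..<?k}" using orbit_conv_funpow_dist1[OF self] orb by (simp add: e_def)
    moreover have "inj_on (e v c) {0..<?k}" using inj_on_funpow_dist1[OF self] by (simp add: e_def)
    ultimately have bij: "bij_betw (e v c) {0..<?k} C" by (simp add: bij_betw_def)
    then have "card C = ?k" using bij_betw_same_card by fastforce
    moreover have "e v c ?k = c" using funpow_dist1_prop[OF self] by (simp add: e_def)
    ultimately show ?thesis using bij by simp
  qed
  define k where "k = card B"
  have e1: "bij_betw (e w b) {0..<k} B" "e w b k = b"
    using enum[OF fin(1) w b] k_def by auto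
  have e2: "bij_betw (e w' b') {0..<k} B'" "e w' b' k = b'"
    using enum[OF fin(2) w' b'] k_def card by auto
  define h where "h = e w' b' \<circ> inv_into {0..<k} (e w b)"
  have h: "bij_betw h B B'"
    unfolding h_def by (rule bij_betw_trans[OF bij_betw_inv_into[OF e1(1)] e2(1)])
  have he: "h (e w b i) = e w' b' i" if "i < k" for i
    unfolding h_def using bij_betw_inv_into_left[OF e1(1), of i] that by simp
  have k0: "0 < k" using b fin k_def by (auto simp: card_gt_0_iff)
  have conj: "h (w x) = w' (h x)" if x: "x \<in> B" for x
  proof -
    obtain i where i: "i < k" "x = e w b i"
      using x bij_betw_imp_surj_on[OF e1(1)] by auto
    \<comment> \<open>At the last index \<open>k - 1\<close> both lists wrap around to their base
      points; \<open>he\<close> only covers indices below \<open>k\<close>.\<close>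
    have "h (e w b (Suc i)) = e w' b' (Suc i)"
    proof (cases "Suc i = k")
      case True
      then show ?thesis using e1(2) e2(2) he[OF k0] by (simp add: e_def)
    next
      case False
      then show ?thesis using he[of "Suc i"] i by simp
    qed
    then show ?thesis using he[OF i(1)] i(2) by (simp add: e_def)
  qed
  have "map_permutation B h w = w'"
  proof
    fix y
    show "map_permutation B h w y = w' y"
    proof (cases "y \<in> B'")
      case True
      then obtain x where x: "x \<in> B" "y = h x" using bij_betw_imp_surj_on[OF h] by auto
      then show ?thesis
        using map_permutation_apply[OF bij_betw_imp_inj_on[OF h] x(1)] conj by simp
    next
      case False
      then show ?thesis
        using permutes_not_in[OF map_permutation_permutes[OF h full_cycles_permutes[OF w]]]
          permutes_not_in[OF full_cycles_permutes[OF w']] by simp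
    qed
  qed
  then show thesis using h that by blast
qed

text \<open>For \<open>w = inv D\<close> with \<open>D\<close> a full cycle,
  \<open>C \<circ> w\<close> is the quotient of \<open>C\<close> by \<open>D\<close>; this is how
  the quantity arises below.\<close>

definition cycle_quotients :: "nat set \<Rightarrow> (nat \<Rightarrow> nat) \<Rightarrow> nat \<Rightarrow> nat" where
  "cycle_quotients B w m = card {C \<in> full_cycles B. orbit_count B (C \<circ> w) = m}"

text \<open>Conjugation by a relabelling that takes \<open>w\<close> to \<open>w'\<close> maps the
  solutions for \<open>w\<close> injectively to solutions for \<open>w'\<close>. This yields one
  inequality, and the situation is symmetric.\<close>

lemma cycle_quotients_cong:
  assumes fin: "finite B" "finite B'" and ne: "B \<noteq> {}" and card: "card B = card B'"
    and w: "w \<in> full_cycles B" and w': "w' \<in> full_cycles B'"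
  shows "cycle_quotients B w m = cycle_quotients B' w' m"
proof -
  have le: "cycle_quotients B w m \<le> cycle_quotients B' w' m"
    if fin: "finite B" "finite B'" and ne: "B \<noteq> {}" and card: "card B = card B'"
    and w: "w \<in> full_cycles B" and w': "w' \<in> full_cycles B'" for B B' w w'
  proof -
    obtain h where h: "bij_betw h B B'" and hw: "map_permutation B h w = w'"
      by (rule full_cycles_conjugate[OF fin ne card w w'])
    have inj: "inj_on h B" using h by (rule bij_betw_imp_inj_on)
    have "inj_on (map_permutation B h) {C \<in> full_cycles B. orbit_count B (C \<circ> w) = m}"
    proof (rule inj_on_inverseI)
      fix C assume "C \<in> {C \<in> full_cycles B. orbit_count B (C \<circ> w) = m}"
      then have "C permutes B" by (simp add: full_cycles_def)
      then show "map_permutation B' (inv_into B h) (map_permutation B h C) = C"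
        by (rule map_permutation_compose_inv[OF h]) (rule inv_into_f_f[OF inj])
    qed
    moreover have "map_permutation B h ` {C \<in> full_cycles B. orbit_count B (C \<circ> w) = m}
        \<subseteq> {C \<in> full_cycles B'. orbit_count B' (C \<circ> w') = m}"
    proof
      fix E assume "E \<in> map_permutation B h ` {C \<in> full_cycles B. orbit_count B (C \<circ> w) = m}"
      then obtain C where C: "C \<in> full_cycles B" "orbit_count B (C \<circ> w) = m"
        and E: "E = map_permutation B h C" by auto
      have wp: "w permutes B" and Cp: "C permutes B" using w C full_cycles_permutes by auto
      have "E \<circ> w' = map_permutation B h (C \<circ> w)"
        unfolding E hw[symmetric] by (rule map_permutation_compose'[OF inj wp, symmetric])
      then have "orbit_count B' (E \<circ> w') = m"
        using orbit_count_map_permutation[OF h permutes_compose[OF wp Cp]] C by simp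
      moreover have "E \<in> full_cycles B'"
        using orbit_count_map_permutation[OF h Cp] map_permutation_permutes[OF h Cp] C E
        by (simp add: full_cycles_def)
      ultimately show "E \<in> {C \<in> full_cycles B'. orbit_count B' (C \<circ> w') = m}" by simp
    qed
    ultimately show ?thesis
      unfolding cycle_quotients_def using fin by (intro card_inj_on_le[of "map_permutation B h"]) auto
  qed
  have ne': "B' \<noteq> {}" using ne card fin by auto
  show ?thesis
    using le[OF fin ne card w w'] le[OF fin(2,1) ne' card[symmetric] w' w] by simp
qed

section \<open>Double counting\<close>

lemma sum_card_swap:
  assumes "finite A" "finite B"
  shows "(\<Sum>x\<in>A. card {y \<in> B. R x y}) = (\<Sum>y\<in>B. card {x \<in> A. R x y})"
  using sum.swap_restrict[OF assms, of "\<lambda>_ _. 1::nat" R] by simp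

text \<open>On a set \<open>A\<close> with one more point, the triples of \<open>s\<close> with
  \<open>m\<close> cycles, a marked point \<open>j\<close> and a full cycle \<open>D\<close> on
  \<open>A - {j}\<close> with \<open>s \<circ> D\<close> a full cycle are counted twice: over
  \<open>s\<close> by the sign of \<open>s\<close>, and over \<open>j\<close> and \<open>D\<close>
  by reducing to \<open>B\<close>.\<close>

lemma card_cycle_quotients:
  assumes fin: "finite B" and ne: "B \<noteq> {}" and w: "w \<in> full_cycles B"
  shows "Suc (card B) * card B * cycle_quotients B w m
       = (if even (card B + m) then 2 * stirling (Suc (card B)) m else 0)"
proof -
  define k where "k = card B"
  have k0: "k > 0" using fin ne k_def by (simp add: card_gt_0_iff)
  obtain y where y: "y \<notin> B" using ex_new_if_finite[OF infinite_UNIV_nat fin] by auto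
  define A where "A = insert y B"
  have finA: "finite A" and cardA: "card A = Suc k" using fin y A_def k_def by auto
  define P where "P = {s. s permutes A \<and> orbit_count A s = m}"
  have finP: "finite P"
    unfolding P_def by (rule finite_subset[OF _ finite_permutations[OF finA]]) auto
  have cardP: "card P = stirling (Suc k) m"
    using card_permutes_orbit_count[OF finA] cardA P_def by simp
  have lhs: "(\<Sum>s\<in>P. \<Sum>j\<in>A. near_cycle_pairs A s j)
      = (if even (k + m) then 2 * stirling (Suc k) m * fact (k - 1) else 0)"
  proof -
    have "(\<Sum>j\<in>A. near_cycle_pairs A s j) = (if even (k + m) then 2 * fact (k - 1) else 0)"
      if s: "s \<in> P" for s
    proof -
      have p: "s permutes A" and c: "orbit_count A s = m" using s P_def by auto
      have sg: "sign s = (- 1) ^ (Suc k + m)" using sign_orbit_count[OF finA p] c cardA by simp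
      show ?thesis
      proof (cases "even (k + m)")
        case True
        then have "sign s = - 1" using sg by simp
        then show ?thesis using sum_near_cycle_pairs_odd[OF finA p] True cardA by simp
      next
        case False
        then have "sign s = 1" using sg by simp
        then show ?thesis using near_cycle_pairs_even[OF finA _ p] False cardA k0 by simp
      qed
    qed
    then show ?thesis using cardP by simp
  qed
  \<comment> \<open>For fixed \<open>D\<close>, the permutation \<open>s\<close> is recovered from
    the full cycle \<open>C = s \<circ> D\<close> as \<open>C \<circ> inv D\<close>.\<close>
  have quot: "card {s \<in> P. s \<circ> D \<in> full_cycles A} = k * cycle_quotients B w m"
    if j: "j \<in> A" and D: "D \<in> full_cycles (A - {j})" for j D
  proof -
    let ?B = "A - {j}"
    have finB: "finite ?B" using finA by simp
    have cB: "card ?B = k" using finA j cardA by simp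
    have neB: "?B \<noteq> {}" using cB k0 by (metis card.empty less_irrefl)
    have Dp: "D permutes ?B" using D by (rule full_cycles_permutes)
    have DA: "D permutes A" by (rule permutes_subset[OF Dp]) auto
    have iD: "inv D \<in> full_cycles ?B" by (rule inv_full_cycles[OF finB D])
    have iDp: "inv D permutes ?B" by (rule permutes_inv[OF Dp])
    have "bij_betw (\<lambda>s. s \<circ> D) {s \<in> P. s \<circ> D \<in> full_cycles A}
        {C \<in> full_cycles A. orbit_count A (C \<circ> inv D) = m}"
    proof (rule bij_betwI[where g = "\<lambda>C. C \<circ> inv D"])
      have r: "s \<circ> D \<circ> inv D = s" "s \<circ> inv D \<circ> D = s" for s :: "nat \<Rightarrow> nat"
        using permutes_inv_o[OF Dp] by (auto simp: comp_assoc)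
      show "(\<lambda>s. s \<circ> D) \<in> {s \<in> P. s \<circ> D \<in> full_cycles A}
          \<rightarrow> {C \<in> full_cycles A. orbit_count A (C \<circ> inv D) = m}"
        by (auto simp: r P_def)
      show "(\<lambda>C. C \<circ> inv D) \<in> {C \<in> full_cycles A. orbit_count A (C \<circ> inv D) = m}
          \<rightarrow> {s \<in> P. s \<circ> D \<in> full_cycles A}"
        using permutes_compose[OF permutes_inv[OF DA]] by (auto simp: r P_def full_cycles_permutes)
      show "s \<circ> D \<circ> inv D = s" "s \<circ> inv D \<circ> D = s" for s :: "nat \<Rightarrow> nat" by (rule r)+
    qed
    then have "card {s \<in> P. s \<circ> D \<in> full_cycles A}
        = card {C \<in> full_cycles A. orbit_count A (C \<circ> inv D) = m}"
      by (rule bij_betw_same_card)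
    also have "\<dots> = (\<Sum>b\<in>?B. card {C \<in> full_cycles ?B. orbit_count A (transpose j b \<circ> C \<circ> inv D) = m})"
      using card_full_cycles_by_image[OF finA j neB, of "\<lambda>C. orbit_count A (C \<circ> inv D) = m"] by simp
    also have "\<dots> = (\<Sum>b\<in>?B. cycle_quotients ?B (inv D) m)"
    proof (rule sum.cong[OF refl])
      fix b assume b: "b \<in> ?B"
      \<comment> \<open>Both \<open>C\<close> and \<open>inv D\<close> fix \<open>j\<close>, so the
        transposition on the left merely inserts \<open>j\<close> into the product on
        \<open>?B\<close> and leaves the number of cycles unchanged.\<close>
      have "orbit_count A (transpose j b \<circ> C \<circ> inv D) = orbit_count ?B (C \<circ> inv D)"
        if C: "C \<in> full_cycles ?B" for C
        using orbit_count_insert_transpose[OF finB permutes_compose[OF iDp full_cycles_permutes[OF C]], of j b]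
          b j by (simp add: comp_assoc insert_absorb)
      then have "{C \<in> full_cycles ?B. orbit_count A (transpose j b \<circ> C \<circ> inv D) = m}
          = {C \<in> full_cycles ?B. orbit_count ?B (C \<circ> inv D) = m}" by auto
      then show "card {C \<in> full_cycles ?B. orbit_count A (transpose j b \<circ> C \<circ> inv D) = m}
          = cycle_quotients ?B (inv D) m"
        unfolding cycle_quotients_def by (rule arg_cong)
    qed
    \<comment> \<open>The number of quotients depends only on the size of the carrier, so
      \<open>inv D\<close> on \<open>A - {j}\<close> may be replaced by \<open>w\<close> on
      \<open>B\<close>; there are \<open>k\<close> choices of \<open>b\<close>.\<close>
    also have "\<dots> = k * cycle_quotients B w m"
      using cycle_quotients_cong[OF finB fin neB _ iD w] cB k_def by simp
    finally show ?thesis .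
  qed
  have "(\<Sum>s\<in>P. \<Sum>j\<in>A. near_cycle_pairs A s j)
      = (\<Sum>j\<in>A. \<Sum>s\<in>P. card {D \<in> full_cycles (A - {j}). s \<circ> D \<in> full_cycles A})"
    unfolding near_cycle_pairs_def by (rule sum.swap)
  also have "\<dots> = (\<Sum>j\<in>A. \<Sum>D\<in>full_cycles (A - {j}). card {s \<in> P. s \<circ> D \<in> full_cycles A})"
    using finP finA by (intro sum.cong refl sum_card_swap) auto
  also have "\<dots> = (\<Sum>j\<in>A. \<Sum>D\<in>full_cycles (A - {j}). k * cycle_quotients B w m)"
    using quot by (intro sum.cong refl) auto
  also have "\<dots> = (\<Sum>j\<in>A. fact (k - 1) * (k * cycle_quotients B w m))"
  proof (rule sum.cong[OF refl])
    fix j assume j: "j \<in> A"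
    have "card (A - {j}) = k" using finA j cardA by simp
    moreover have "A - {j} \<noteq> {}" using calculation k0 by (metis card.empty less_irrefl)
    ultimately have "card (full_cycles (A - {j})) = fact (k - 1)"
      using card_full_cycles[of "A - {j}"] finA by simp
    then show "(\<Sum>D\<in>full_cycles (A - {j}). k * cycle_quotients B w m)
        = fact (k - 1) * (k * cycle_quotients B w m)" by simp
  qed
  also have "\<dots> = fact (k - 1) * (Suc k * k * cycle_quotients B w m)"
    using cardA by (simp add: algebra_simps)
  finally have "fact (k - 1) * (Suc k * k * cycle_quotients B w m)
      = fact (k - 1) * (if even (k + m) then 2 * stirling (Suc k) m else 0)"
    using lhs by (simp split: if_splits)
  then have "Suc k * k * cycle_quotients B w m = (if even (k + m) then 2 * stirling (Suc k) m else 0)"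
    by (subst (asm) mult_left_cancel) (rule fact_nonzero)
  then show ?thesis unfolding k_def .
qed

section \<open>Hook types\<close>

lemma omega_full_cycle:
  assumes n: "0 < n"
  shows "omega n \<in> full_cycles {1..n}"
proof -
  have "bij_betw (omega n) {1..n} {1..n}"
    by (rule bij_betwI[where g = "\<lambda>i. if i = 1 then n else i - 1"]) (auto simp: omega_def)
  then have p: "omega n permutes {1..n}"
    by (rule bij_imp_permutes) (auto simp: omega_def)
  have pow: "(omega n ^^ i) 1 = Suc i" if "i < n" for i
    using that by (induction i) (auto simp: omega_def)
  have "{1..n} \<subseteq> cyc_orbit (omega n) 1"
  proof
    fix x assume x: "x \<in> {1..n}"
    then have "x = (omega n ^^ (x - 1)) 1" using pow[of "x - 1"] by auto
    then show "x \<in> cyc_orbit (omega n) 1" unfolding cyc_orbit_def by blast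
  qed
  then show ?thesis using p n by (intro full_cyclesI[where b = 1]) auto
qed

text \<open>A permutation \<open>C\<close> of \<open>S\<close> fixes every \<open>y\<close> in
  \<open>R\<close>, so a transposition moving \<open>y\<close> can be pushed to the left through
  \<open>C\<close> and cut off there. The resulting \<open>w'\<close> is the same for all
  \<open>C\<close>, which allows counting over \<open>C\<close>.\<close>

lemma full_cycle_reduce:
  assumes "finite R" "finite S" "S \<noteq> {}" "R \<inter> S = {}" "w \<in> full_cycles (S \<union> R)"
  shows "\<exists>w'\<in>full_cycles S. \<forall>C. C permutes S \<longrightarrow> orbit_count (S \<union> R) (C \<circ> w) = orbit_count S (C \<circ> w')"
  using assms
proof (induction R arbitrary: w rule: finite_induct)
  case empty
  then show ?case by auto
next
  case (insert y R)
  let ?B = "S \<union> R"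
  have w: "w \<in> full_cycles (insert y ?B)" using insert.prems by simp
  have fin: "finite ?B" "finite (insert y ?B)" using insert by auto
  have yB: "y \<notin> ?B" using insert by auto
  have B: "insert y ?B - {y} = ?B" using yB by auto
  have wp: "w permutes insert y ?B" using w by (rule full_cycles_permutes)
  have wy: "w y \<noteq> y"
    by (rule full_cycles_nofix[OF fin(2) w]) (use B insert.prems in auto)
  let ?v = "transpose y (w y) \<circ> w"
  have v: "?v \<in> full_cycles ?B"
    using full_cycles_cut_iff[OF fin(2) wp _ wy] w B by simp
  have wyB: "w y \<in> ?B" using permutes_in_image[OF wp, of y] wy by auto
  have RS: "R \<inter> S = {}" using insert.prems by auto
  obtain w' where w': "w' \<in> full_cycles S"
    and red: "\<And>C. C permutes S \<Longrightarrow> orbit_count ?B (C \<circ> ?v) = orbit_count S (C \<circ> w')"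
    using insert.IH[OF insert.prems(1,2) RS v] by blast
  have "orbit_count (insert y ?B) (C \<circ> w) = orbit_count ?B (C \<circ> ?v)" if C: "C permutes S" for C
  proof -
    have Cy: "C y = y" by (rule permutes_not_in[OF C]) (use yB in auto)
    have CB: "C permutes ?B" by (rule permutes_subset[OF C]) auto
    have inj: "C u = C v \<longleftrightarrow> u = v" for u v using permutes_inj[OF C] by (simp add: inj_eq)
    have conj: "C \<circ> transpose y (w y) = transpose y (C (w y)) \<circ> C"
    proof
      fix x
      show "(C \<circ> transpose y (w y)) x = (transpose y (C (w y)) \<circ> C) x"
        using inj[of x y] inj[of x "w y"] Cy by (auto simp: transpose_def)
    qed
    have "C \<circ> (transpose y (w y) \<circ> ?v) = (C \<circ> transpose y (w y)) \<circ> ?v"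
      by (rule comp_assoc[symmetric])
    also have "\<dots> = transpose y (C (w y)) \<circ> (C \<circ> ?v)" unfolding conj by (rule comp_assoc)
    finally have "C \<circ> w = transpose y (C (w y)) \<circ> (C \<circ> ?v)" by simp
    moreover have "C (w y) \<in> ?B" using permutes_in_image[OF CB] wyB by simp
    ultimately show ?thesis
      using orbit_count_insert_transpose[OF fin(1) permutes_compose[OF full_cycles_permutes[OF v] CB] yB]
      by simp
  qed
  then have "\<forall>C. C permutes S \<longrightarrow> orbit_count (S \<union> insert y R) (C \<circ> w) = orbit_count S (C \<circ> w')"
    using red by simp
  then show ?case using w' by blast
qed

section \<open>Permutations of hook type and factorizations of \<open>omega\<close>\<close>

lemma cycles_of_full_cycle:
  assumes S: "finite S" "S \<noteq> {}" "S \<subseteq> {1..n}" and s: "s \<in> full_cycles S"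
  shows "cycles_of n s = insert S ((\<lambda>x. {x}) ` ({1..n} - S))"
proof -
  have p: "s permutes S" using s by (rule full_cycles_permutes)
  have "cyc_orbit s ` S = {S}"
    using full_cycles_orbit[OF S(1) s] S(2) by auto
  moreover have "cyc_orbit s ` ({1..n} - S) = (\<lambda>x. {x}) ` ({1..n} - S)"
    by (intro image_cong refl cyc_orbit_fixed permutes_not_in[OF p]) auto
  moreover have "{1..n} = S \<union> ({1..n} - S)" using S by auto
  ultimately have "cyc_orbit s ` {1..n} = {S} \<union> (\<lambda>x. {x}) ` ({1..n} - S)"
    using image_Un[of "cyc_orbit s" S "{1..n} - S"] by simp
  then show ?thesis unfolding cycles_of_def by simp
qed

text \<open>From right to left the orbits are \<open>S\<close> and singletons. Conversely, some
  orbit has size \<open>n - p\<close>; removing its size from the multiset leaves only ones, so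
  every point outside that orbit is fixed.\<close>

lemma cycle_type_hook_iff:
  assumes pn: "p < n" and s: "s permutes {1..n}"
  shows "cycle_type n s = hook_type n p \<longleftrightarrow> (\<exists>S\<subseteq>{1..n}. card S = n - p \<and> s \<in> full_cycles S)"
proof
  assume "\<exists>S\<subseteq>{1..n}. card S = n - p \<and> s \<in> full_cycles S"
  then obtain S where S: "S \<subseteq> {1..n}" "card S = n - p" "s \<in> full_cycles S" by auto
  have fin: "finite S" using S(1) finite_subset by blast
  have ne: "S \<noteq> {}" using S(2) pn by auto
  \<comment> \<open>\<open>S\<close> may itself be a singleton; it must still be a new element next
    to the singletons of the outside points.\<close>
  have notin: "S \<notin> (\<lambda>x. {x}) ` ({1..n} - S)" by auto
  have "card ({1..n} - S) = p" using S fin pn by (simp add: card_Diff_subset)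
  moreover have "image_mset card (mset_set ((\<lambda>x. {x}) ` ({1..n} - S)))
      = replicate_mset (card ({1..n} - S)) 1"
    by (subst image_mset_mset_set[symmetric]) (auto simp: multiset.map_comp o_def image_mset_const_eq)
  ultimately show "cycle_type n s = hook_type n p"
    unfolding cycle_type_def cycles_of_full_cycle[OF fin ne S(1,3)] hook_type_def
    using notin S(2) by simp
next
  assume ct: "cycle_type n s = hook_type n p"
  have fin: "finite (cycles_of n s)" by (simp add: cycles_of_def)
  have "n - p \<in># cycle_type n s" unfolding ct by (simp add: hook_type_def)
  then obtain X where X: "X \<in> cycles_of n s" "card X = n - p"
    unfolding cycle_type_def using fin by auto
  have "cycle_type n s = add_mset (card X) (image_mset card (mset_set (cycles_of n s - {X})))"
    unfolding cycle_type_def by (simp only: mset_set.remove[OF fin X(1)] image_mset_add_mset)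
  then have rest: "image_mset card (mset_set (cycles_of n s - {X})) = replicate_mset p 1"
    using ct X(2) by (simp add: hook_type_def)
  have one: "card Y = 1" if "Y \<in> cycles_of n s - {X}" for Y
  proof -
    have "card Y \<in># image_mset card (mset_set (cycles_of n s - {X}))" using that fin by auto
    then show ?thesis unfolding rest by (simp split: if_splits)
  qed
  obtain x where x: "x \<in> {1..n}" "X = cyc_orbit s x" using X(1) by (auto simp: cycles_of_def)
  have sub: "X \<subseteq> {1..n}" unfolding x(2) by (rule cyc_orbit_subset_carrier[OF s x(1)])
  have "s y = y" if y: "y \<in> {1..n} - X" for y
  proof -
    have "cyc_orbit s y \<noteq> X" using y self_in_cyc_orbit[of y s] by blast
    then have "card (cyc_orbit s y) = 1" using one[of "cyc_orbit s y"] y by (auto simp: cycles_of_def)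
    then obtain z where z: "cyc_orbit s y = {z}" by (rule card_1_singletonE)
    show ?thesis using self_in_cyc_orbit[of y s] cyc_orbit_step[of y s y] unfolding z by simp
  qed
  then have p: "s permutes X" by (rule permutes_superset[OF s])
  have "s \<in> full_cycles X"
    by (rule full_cyclesI[OF finite_subset[OF sub] p, of x]) (use x in auto)
  then show "\<exists>S\<subseteq>{1..n}. card S = n - p \<and> s \<in> full_cycles S" using sub X(2) by blast
qed

lemma full_cycles_support:
  assumes "finite S" "card S \<ge> 2" "s \<in> full_cycles S"
  shows "S = {x. s x \<noteq> x}"
proof -
  have move: "s x \<noteq> x" if "x \<in> S" for x
  proof (rule full_cycles_nofix[OF assms(1,3) that])
    have "card (S - {x}) \<noteq> 0" using assms that by simp
    then show "S - {x} \<noteq> {}" by (metis card.empty)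
  qed
  have fix_outside: "s x = x" if "x \<notin> S" for x
    by (rule permutes_not_in[OF full_cycles_permutes[OF assms(3)] that])
  show ?thesis by (intro set_eqI) (use move fix_outside in blast)
qed

text \<open>With at least two points in the long cycle, \<open>S\<close> is the set of moved points,
  so different \<open>S\<close> give disjoint families. For \<open>n - p = 1\<close> every
  \<open>S\<close> would give the identity.\<close>

lemma card_hook_type:
  assumes pn: "p < n" and np: "n - p \<ge> 2"
  shows "card {s. s permutes {1..n} \<and> cycle_type n s = hook_type n p \<and> P s}
       = (\<Sum>S | S \<subseteq> {1..n} \<and> card S = n - p. card {s \<in> full_cycles S. P s})"
proof -
  let ?I = "{S. S \<subseteq> {1..n} \<and> card S = n - p}"
  have finI: "finite ?I" by (rule finite_subset[of _ "Pow {1..n}"]) auto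
  have finS: "finite S" if "S \<in> ?I" for S using that finite_subset[of S "{1..n}"] by auto
  have un: "{s. s permutes {1..n} \<and> cycle_type n s = hook_type n p \<and> P s} = (\<Union>S\<in>?I. {s \<in> full_cycles S. P s})"
  proof (rule set_eqI)
    fix s
    have "s permutes {1..n}" if "S \<in> ?I" "s \<in> full_cycles S" for S
      using permutes_subset[OF full_cycles_permutes[OF that(2)]] that(1) by blast
    then have "s permutes {1..n} \<and> cycle_type n s = hook_type n p \<longleftrightarrow> (\<exists>S\<in>?I. s \<in> full_cycles S)"
      using cycle_type_hook_iff[OF pn, of s] by auto
    then show "s \<in> {s. s permutes {1..n} \<and> cycle_type n s = hook_type n p \<and> P s}
        \<longleftrightarrow> s \<in> (\<Union>S\<in>?I. {s \<in> full_cycles S. P s})" by blast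
  qed
  have disj: "{s \<in> full_cycles S. P s} \<inter> {s \<in> full_cycles T. P s} = {}"
    if "S \<in> ?I" "T \<in> ?I" "S \<noteq> T" for S T
  proof -
    have "s \<notin> full_cycles T" if s: "s \<in> full_cycles S" for s
    proof
      assume t: "s \<in> full_cycles T"
      have "S = {x. s x \<noteq> x}"
        by (rule full_cycles_support[OF finS _ s]) (use that(1) \<open>S \<in> ?I\<close> np in auto)
      moreover have "T = {x. s x \<noteq> x}"
        by (rule full_cycles_support[OF finS _ t]) (use \<open>T \<in> ?I\<close> np in auto)
      ultimately show False using \<open>S \<noteq> T\<close> by simp
    qed
    then show ?thesis by blast
  qed
  have finC: "finite {s \<in> full_cycles S. P s}" if "S \<in> ?I" for S using finS[OF that] by simp
  show ?thesis unfolding un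
    by (rule card_UN_disjoint[OF finI]) (use finC disj in blast)+
qed

text \<open>The first factor determines the second as \<open>inv s \<circ> omega n\<close>, so the
  pairs are counted by their first component.\<close>

lemma mu_eq_card:
  assumes n: "0 < n"
  shows "mu n m g = card {s. s permutes {1..n} \<and> cycle_type n s = g
      \<and> orbit_count {1..n} (inv s \<circ> omega n) = m}"
proof -
  have om: "omega n permutes {1..n}" using omega_full_cycle[OF n] by (rule full_cycles_permutes)
  have l: "inv s \<circ> (s \<circ> t) = t" "s \<circ> (inv s \<circ> t) = t" if "s permutes {1..n}" for s t :: "nat \<Rightarrow> nat"
    using permutes_inv_o[OF that] by (simp_all add: comp_assoc[symmetric])
  have pq: "inv s \<circ> omega n permutes {1..n}" if "s permutes {1..n}" for s
    by (rule permutes_compose[OF om permutes_inv[OF that]])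
  have nc: "num_cycles n t = orbit_count {1..n} t" for t
    by (simp add: num_cycles_def cycles_of_def orbit_count_def)
  let ?L = "{s. s permutes {1..n} \<and> cycle_type n s = g \<and> orbit_count {1..n} (inv s \<circ> omega n) = m}"
  let ?R = "{(s, t). s permutes {1..n} \<and> t permutes {1..n} \<and> s \<circ> t = omega n
        \<and> cycle_type n s = g \<and> num_cycles n t = m}"
  have "?R = (\<lambda>s. (s, inv s \<circ> omega n)) ` ?L"
  proof (intro subset_antisym subsetI)
    fix x assume "x \<in> ?R"
    then obtain s t where st: "x = (s, t)" "s permutes {1..n}" "s \<circ> t = omega n"
      "cycle_type n s = g" "orbit_count {1..n} t = m" by (auto simp: nc)
    have "t = inv s \<circ> omega n" using l(1)[OF st(2), of t] st(3) by simp
    then show "x \<in> (\<lambda>s. (s, inv s \<circ> omega n)) ` ?L" using st by blast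
  next
    fix x assume "x \<in> (\<lambda>s. (s, inv s \<circ> omega n)) ` ?L"
    then obtain s where s: "x = (s, inv s \<circ> omega n)" "s permutes {1..n}"
      "cycle_type n s = g" "orbit_count {1..n} (inv s \<circ> omega n) = m" by blast
    show "x \<in> ?R" using s pq[OF s(2)] l(2)[OF s(2), of "omega n"] by (simp add: nc)
  qed
  then show ?thesis unfolding mu_def by (simp add: card_image inj_on_def)
qed

text \<open>For each support \<open>S\<close>, \<open>omega n\<close> reduces to a full cycle on
  \<open>S\<close>, and inversion permutes the full cycles of \<open>S\<close>. Every
  \<open>S\<close> therefore contributes the same number of quotients.\<close>

lemma mu_hook_type:
  assumes pn: "p < n" and np: "n - p \<ge> 2" and w: "w \<in> full_cycles {1..n - p}"
  shows "mu n m (hook_type n p) = (n choose (n - p)) * cycle_quotients {1..n - p} w m"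
proof -
  let ?I = "{S. S \<subseteq> {1..n} \<and> card S = n - p}"
  have n0: "0 < n" using pn by simp
  have "card {s \<in> full_cycles S. orbit_count {1..n} (inv s \<circ> omega n) = m}
      = cycle_quotients {1..n - p} w m" if S: "S \<in> ?I" for S
  proof -
    have sub: "S \<subseteq> {1..n}" and cS: "card S = n - p" using S by auto
    have fin: "finite S" using finite_subset[OF sub] by simp
    have ne: "S \<noteq> {}" using cS pn by auto
    have un: "S \<union> ({1..n} - S) = {1..n}" using sub by auto
    obtain w' where w': "w' \<in> full_cycles S" and red: "\<And>C. C permutes S \<Longrightarrow>
        orbit_count {1..n} (C \<circ> omega n) = orbit_count S (C \<circ> w')"
      using full_cycle_reduce[of "{1..n} - S" S "omega n"] fin ne omega_full_cycle[OF n0]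
      unfolding un by auto
    have "card {s \<in> full_cycles S. orbit_count {1..n} (inv s \<circ> omega n) = m}
        = card {s \<in> full_cycles S. orbit_count {1..n} (s \<circ> omega n) = m}"
      by (rule card_full_cycles_inv[OF fin])
    also have "{s \<in> full_cycles S. orbit_count {1..n} (s \<circ> omega n) = m}
        = {s \<in> full_cycles S. orbit_count S (s \<circ> w') = m}"
      using red full_cycles_permutes by auto
    also have "card \<dots> = cycle_quotients S w' m" by (simp add: cycle_quotients_def)
    also have "\<dots> = cycle_quotients {1..n - p} w m"
      by (rule cycle_quotients_cong[OF fin _ ne _ w' w]) (simp_all add: cS)
    finally show ?thesis .
  qed
  then have "mu n m (hook_type n p) = (\<Sum>S\<in>?I. cycle_quotients {1..n - p} w m)"
    unfolding mu_eq_card[OF n0] card_hook_type[OF pn np] by (rule sum.cong[OF refl])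
  also have "\<dots> = card ?I * cycle_quotients {1..n - p} w m" by simp
  also have "card ?I = n choose (n - p)" using n_subsets[of "{1..n}" "n - p"] by simp
  finally show ?thesis .
qed

lemma conj_class_size_hook_type:
  assumes pn: "p < n" and np: "n - p \<ge> 2"
  shows "conj_class_size n (hook_type n p) = (n choose (n - p)) * fact (n - p - 1)"
proof -
  let ?I = "{S. S \<subseteq> {1..n} \<and> card S = n - p}"
  have "card (full_cycles S) = fact (n - p - 1)" if S: "S \<in> ?I" for S
  proof -
    have "finite S" "S \<noteq> {}" using S finite_subset[of S "{1..n}"] pn by auto
    then show ?thesis using card_full_cycles[of S] S by simp
  qed
  then have "conj_class_size n (hook_type n p) = (\<Sum>S\<in>?I. fact (n - p - 1))"
    unfolding conj_class_size_def using card_hook_type[OF pn np, of "\<lambda>_. True"] by simp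
  also have "\<dots> = (n choose (n - p)) * fact (n - p - 1)"
    using n_subsets[of "{1..n}" "n - p"] by simp
  finally show ?thesis .
qed

text \<open>The degenerate hook consists of ones only. It is treated separately because the support
  no longer determines \<open>S\<close>.\<close>

lemma hook_type_identity:
  assumes pn: "n = Suc p"
  shows "s permutes {1..n} \<and> cycle_type n s = hook_type n p \<longleftrightarrow> s = id"
proof
  assume "s permutes {1..n} \<and> cycle_type n s = hook_type n p"
  then obtain S where S: "card S = 1" "s \<in> full_cycles S"
    using cycle_type_hook_iff[of p n s] pn by auto
  obtain x where "S = {x}" using S(1) by (rule card_1_singletonE)
  then show "s = id" using S(2) by simp
next
  assume "s = id"
  then show "s permutes {1..n} \<and> cycle_type n s = hook_type n p"
    using cycle_type_hook_iff[of p n s] pn by (auto intro!: exI[of _ "{1}"] simp: permutes_id)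
qed

theorem theorem4p6:
  fixes n p m :: nat
  assumes "p < n" and "0 < m"
  shows "(even (int n - int p - int m) \<longrightarrow>
            real (mu n m (hook_type n p)) =
              2 * real (stirling (n + 1 - p) m) / fact (n + 1 - p)
                * real (conj_class_size n (hook_type n p)))
       \<and> (odd (int n - int p - int m) \<longrightarrow> mu n m (hook_type n p) = 0)"
proof -
  define k where "k = n - p"
  have k: "n + 1 - p = Suc k" "0 < k" using assms(1) k_def by auto
  have par: "even (int n - int p - int m) \<longleftrightarrow> even (k + m)"
  proof -
    have "int n - int p - int m = int (k + m) - 2 * int m" using assms(1) k_def by simp
    moreover have "even (int (k + m) - 2 * int m) \<longleftrightarrow> even (int (k + m))" by presburger
    ultimately show ?thesis by (simp only: even_of_nat_iff)
  qed
  show ?thesis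
  proof (cases "k = 1")
    case True
    then have n: "n = Suc p" using k_def assms(1) by simp
    have cs: "conj_class_size n (hook_type n p) = 1"
      unfolding conj_class_size_def hook_type_identity[OF n] by simp
    have n0: "0 < n" using n by simp
    have "orbit_count {1..n} (inv id \<circ> omega n) = 1"
      using omega_full_cycle[OF n0] by (simp only: inv_id id_comp full_cycles_def mem_Collect_eq)
    moreover have "mu n m (hook_type n p) = card {s. s = id \<and> orbit_count {1..n} (inv s \<circ> omega n) = m}"
      unfolding mu_eq_card[OF n0] by (simp only: conj_assoc[symmetric] hook_type_identity[OF n])
    ultimately have mu: "mu n m (hook_type n p) = (if m = 1 then 1 else 0)"
      by (simp only: Collect_conv_if) auto
    show ?thesis
    proof (cases "m = 1")
      case True
      then show ?thesis unfolding par k(1) mu cs \<open>k = 1\<close> by simp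
    next
      case False
      \<comment> \<open>Here \<open>m\<close> is odd, positive and different from 1, hence greater
        than 2.\<close>
      have "stirling (Suc 1) m = 0" if "even (1 + m)"
      proof (rule stirling_less)
        have "m \<noteq> 2" using that by auto
        then show "Suc 1 < m" using False assms(2) by linarith
      qed
      then show ?thesis unfolding par k(1) mu cs \<open>k = 1\<close> using False by simp
    qed
  next
    case False
    then have k2: "n - p \<ge> 2" using k k_def by simp
    obtain w where w: "w \<in> full_cycles {1..k}" using omega_full_cycle[OF k(2)] by blast
    define q where "q = cycle_quotients {1..k} w m"
    have q: "Suc k * k * q = (if even (k + m) then 2 * stirling (Suc k) m else 0)"
      using card_cycle_quotients[of "{1..k}" w m] w k(2) q_def by simp
    have mu: "mu n m (hook_type n p) = (n choose k) * q"
      using mu_hook_type[OF assms(1) k2, of w m] w unfolding q_def k_def by simp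
    have cs: "conj_class_size n (hook_type n p) = (n choose k) * fact (k - 1)"
      using conj_class_size_hook_type[OF assms(1) k2] unfolding k_def .
    show ?thesis
    proof (cases "even (k + m)")
      case True
      \<comment> \<open>Splitting off two factors leaves the \<open>fact (k - 1)\<close> that occurs
        in the class size and cancels against it; the other two match the factor in
        \<open>q\<close>.\<close>
      have fk: "fact (Suc k) = real (Suc k) * real k * (fact (k - 1) :: real)"
        unfolding fact_Suc[of k] fact_reduce[OF k(2), where 'a = real] by (simp only: mult.assoc)
      have "2 * real (stirling (Suc k) m) = real (Suc k * k * q)" using q True by simp
      moreover have "Suc k * k \<noteq> 0" using k(2) by simp
      then have "real (Suc k * k) \<noteq> 0" by (simp only: of_nat_eq_0_iff not_False_eq_True)
      ultimately have "2 * real (stirling (Suc k) m) / fact (Suc k) * real ((n choose k) * fact (k - 1))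
          = real ((n choose k) * q)"
        unfolding fk of_nat_mult by simp
      then show ?thesis unfolding par k(1) mu cs using True by simp
    next
      case False
      then have "q = 0" using q k(2) by simp
      then show ?thesis unfolding par mu using False by simp
    qed
  qed
qed

end
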